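(* Consider the one-dimensional compressible Euler equations in potential temperature formulation. Let $f^{\mathrm{num}}=(f^{\mathrm{num}}_{\varrho},f^{\mathrm{num}}_{\varrho v},f^{\mathrm{num}}_{\varrho\theta})$ be a two-point numerical flux satisfying $$f^{\mathrm{num}}_{\varrho v}=\{\!\{m/\varrho\}\!\}\,f^{\mathrm{num}}_{\varrho}+\{\!\{p\}\!\},\qquad f^{\mathrm{num}}_{\varrho\theta}=\{\!\{\varrho\theta\}\!\}_{\gamma}\,\{\!\{m/\varrho\}\!\},$$ where $f^{\mathrm{num}}_{\varrho}$ is any consistent and symmetric discretization of $m=\varrho v$. Then $f^{\mathrm{num}}$ is total energy-conservative (TEC).
   Context: The equations are $\partial_t(\varrho,\varrho v,\varrho\theta)^T+\partial_x(\varrho v,\varrho v^2+p,\varrho\theta v)^T=0$ with $\varrho>0$, $\theta>0$, $m=\varrho v$, $p=K(\varrho\theta)^\gamma$, $K=p_0(R/p_0)^\gamma>0$ (constants $R,p_0>0$) and $\gamma>1$. A two-point numerical flux component is a function of a left state $u_-$ and a right state $u_+$; it is symmetric if unchanged when the two states are swapped, and consistent if it equals the exact flux component when $u_-=u_+$. Notation: jump $[\![a]\!]=a_+-a_-$; arithmetic mean $\{\!\{a\}\!\}=(a_++a_-)/2$; Stolarsky mean $\{\!\{a\}\!\}_\gamma=\frac{\gamma-1}{\gamma}\frac{[\![a^\gamma]\!]}{[\![a^{\gamma-1}]\!]}$ for $a_\pm>0$ (extended by continuity by $\{\!\{a\}\!\}_\gamma=a$ if $a_+=a_-=a$). The total energy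 without gravity, $U_{\varrho E}=\varrho E=\frac{K(\varrho\theta)^\gamma}{\gamma-1}+\frac12\frac{m^2}{\varrho}$, has (as a function of $(\varrho,m,\varrho\theta)$) entropy variables $\omega=\left(-\frac12\frac{m^2}{\varrho^2},\frac m\varrho,\frac{\gamma}{\gamma-1}K(\varrho\theta)^{\gamma-1}\right)$ and flux potential $\psi=K(\varrho\theta)^\gamma\frac m\varrho$. A numerical flux is TEC if for all pairs of states $[\![\omega]\!]\cdot f^{\mathrm{num}}=[\![\psi]\!]$, i.e. $$-\tfrac12\Big[\!\Big[\tfrac{m^2}{\varrho^2}\Big]\!\Big]f^{\mathrm{num}}_\varrho+\Big[\!\Big[\tfrac m\varrho\Big]\!\Big]f^{\mathrm{num}}_{\varrho v}+\tfrac{\gamma}{\gamma-1}K[\![(\varrho\theta)^{\gamma-1}]\!]f^{\mathrm{num}}_{\varrho\theta}-K\Big[\!\Big[(\varrho\theta)^\gamma\tfrac m\varrho\Big]\!\Big]=0.$$ *)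

theory Defs
  imports "HOL-Analysis.Analysis"
begin

text \<open>
  A state is the triple of conserved variables
  \<open>(\<rho>, m, \<rho>\<theta>)\<close>, where \<open>m = \<rho> v\<close>; flux vectors are triples in the same order, so the
  projections below serve for both.
\<close>

type_synonym state = "real \<times> real \<times> real"

type_synonym numflux = "state \<Rightarrow> state \<Rightarrow> state"

abbreviation comp_rho :: "state \<Rightarrow> real" where
  "comp_rho u \<equiv> fst u"

abbreviation comp_mom :: "state \<Rightarrow> real" where
  "comp_mom u \<equiv> fst (snd u)"

abbreviation comp_rhotheta :: "state \<Rightarrow> real" where
  "comp_rhotheta u \<equiv> snd (snd u)"

definition velocity :: "state \<Rightarrow> real" where
  "velocity u = comp_mom u / comp_rho u"

definition pot_temp :: "state \<Rightarrow> real" where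
  "pot_temp u = comp_rhotheta u / comp_rho u"

definition admissible :: "state set" where
  "admissible = {u. comp_rho u > 0 \<and> pot_temp u > 0}"

definition pressure_const :: "real \<Rightarrow> real \<Rightarrow> real \<Rightarrow> real" where
  "pressure_const R p0 \<gamma> = p0 * (R / p0) powr \<gamma>"

definition pressure :: "real \<Rightarrow> real \<Rightarrow> real \<Rightarrow> state \<Rightarrow> real" where
  "pressure R p0 \<gamma> u = pressure_const R p0 \<gamma> * comp_rhotheta u powr \<gamma>"

definition euler_flux :: "real \<Rightarrow> real \<Rightarrow> real \<Rightarrow> state \<Rightarrow> state" where
  "euler_flux R p0 \<gamma> u =
     (comp_rho u * velocity u,
      comp_rho u * (velocity u)\<^sup>2 + pressure R p0 \<gamma> u,
      comp_rhotheta u * velocity u)"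

text \<open>
  Jump and means take the left value first. They are applied to values, so the jump of a
  function \<open>w\<close> of the state is \<open>jump (w uL) (w uR)\<close>.
\<close>

definition jump :: "'a::ab_group_add \<Rightarrow> 'a \<Rightarrow> 'a" where
  "jump aL aR = aR - aL"

definition amean :: "real \<Rightarrow> real \<Rightarrow> real" where
  "amean aL aR = (aL + aR) / 2"

definition stolarsky_mean :: "real \<Rightarrow> real \<Rightarrow> real \<Rightarrow> real" where
  "stolarsky_mean \<gamma> aL aR =
     (if aL = aR then aL
      else (\<gamma> - 1) / \<gamma> * (jump (aL powr \<gamma>) (aR powr \<gamma>)
             / jump (aL powr (\<gamma> - 1)) (aR powr (\<gamma> - 1))))"

definition symmetric_flux :: "(state \<Rightarrow> state \<Rightarrow> real) \<Rightarrow> bool" where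
  "symmetric_flux g \<longleftrightarrow> (\<forall>uL\<in>admissible. \<forall>uR\<in>admissible. g uL uR = g uR uL)"

definition consistent_flux :: "(state \<Rightarrow> state \<Rightarrow> real) \<Rightarrow> (state \<Rightarrow> real) \<Rightarrow> bool" where
  "consistent_flux g h \<longleftrightarrow> (\<forall>u\<in>admissible. g u u = h u)"

definition total_energy :: "real \<Rightarrow> real \<Rightarrow> real \<Rightarrow> state \<Rightarrow> real" where
  "total_energy R p0 \<gamma> u =
     pressure_const R p0 \<gamma> * comp_rhotheta u powr \<gamma> / (\<gamma> - 1)
       + 1 / 2 * ((comp_mom u)\<^sup>2 / comp_rho u)"

definition entropy_vars :: "real \<Rightarrow> real \<Rightarrow> real \<Rightarrow> state \<Rightarrow> state" where
  "entropy_vars R p0 \<gamma> u =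
     (- (1 / 2) * ((comp_mom u)\<^sup>2 / (comp_rho u)\<^sup>2),
      comp_mom u / comp_rho u,
      \<gamma> / (\<gamma> - 1) * pressure_const R p0 \<gamma> * comp_rhotheta u powr (\<gamma> - 1))"

definition flux_potential :: "real \<Rightarrow> real \<Rightarrow> real \<Rightarrow> state \<Rightarrow> real" where
  "flux_potential R p0 \<gamma> u =
     pressure_const R p0 \<gamma> * comp_rhotheta u powr \<gamma> * (comp_mom u / comp_rho u)"

definition TEC :: "real \<Rightarrow> real \<Rightarrow> real \<Rightarrow> numflux \<Rightarrow> bool" where
  "TEC R p0 \<gamma> f \<longleftrightarrow>
     (\<forall>uL\<in>admissible. \<forall>uR\<in>admissible.
        jump (entropy_vars R p0 \<gamma> uL) (entropy_vars R p0 \<gamma> uR) \<bullet> f uL uR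
          = jump (flux_potential R p0 \<gamma> uL) (flux_potential R p0 \<gamma> uR))"

text \<open>
  The explicit formulas above are the gradient of the total energy and the potential belonging
  to the energy flux \<open>(\<rho>E + p) v\<close>.
\<close>

lemma entropy_vars_gradient:
  assumes "u \<in> admissible" "\<gamma> > 1"
  shows "(total_energy R p0 \<gamma> has_derivative (\<lambda>h. entropy_vars R p0 \<gamma> u \<bullet> h)) (at u)"
proof -
  have r: "comp_rho u > 0" and q: "comp_rhotheta u > 0"
    using assms by (auto simp: admissible_def pot_temp_def zero_less_divide_iff)
  have "((\<lambda>u. comp_rhotheta u powr \<gamma>) has_derivative
      (\<lambda>h. \<gamma> * comp_rhotheta u powr (\<gamma> - 1) * comp_rhotheta h)) (at u)"
    by (rule derivative_eq_intros refl q DERIV_powr [THEN DERIV_compose_FDERIV] | use q in \<open>simp add: powr_diff field_simps\<close>)+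
  moreover have "((\<lambda>u. (comp_mom u)\<^sup>2 / comp_rho u) has_derivative
      (\<lambda>h. 2 * (comp_mom u / comp_rho u) * comp_mom h
        - (comp_mom u)\<^sup>2 / (comp_rho u)\<^sup>2 * comp_rho h)) (at u)"
    using r by (auto intro!: derivative_eq_intros simp: fun_eq_iff field_simps power2_eq_square)
  ultimately have "(total_energy R p0 \<gamma> has_derivative
      (\<lambda>h. pressure_const R p0 \<gamma> * (\<gamma> * comp_rhotheta u powr (\<gamma> - 1) * comp_rhotheta h) / (\<gamma> - 1)
        + 1 / 2 * (2 * (comp_mom u / comp_rho u) * comp_mom h
            - (comp_mom u)\<^sup>2 / (comp_rho u)\<^sup>2 * comp_rho h))) (at u)"
    unfolding total_energy_def [abs_def] divide_inverse
    by (intro has_derivative_add has_derivative_mult_left has_derivative_mult_right)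
  then show ?thesis
    by (rule has_derivative_eq_rhs)
      (simp add: entropy_vars_def inner_prod_def fun_eq_iff algebra_simps)
qed

lemma flux_potential_eq:
  assumes "u \<in> admissible" "\<gamma> > 1"
  shows "flux_potential R p0 \<gamma> u =
    entropy_vars R p0 \<gamma> u \<bullet> euler_flux R p0 \<gamma> u
      - (total_energy R p0 \<gamma> u + pressure R p0 \<gamma> u) * velocity u"
proof -
  have r: "comp_rho u > 0" and q: "comp_rhotheta u > 0"
    using assms by (auto simp: admissible_def pot_temp_def zero_less_divide_iff)
  define P where "P = pressure_const R p0 \<gamma> * comp_rhotheta u powr \<gamma>"
  have m: "comp_mom u = velocity u * comp_rho u"
    using r by (simp add: velocity_def)
  have pw: "comp_rhotheta u powr (\<gamma> - 1) * comp_rhotheta u = comp_rhotheta u powr \<gamma>"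
    using q by (simp add: powr_diff)
  have "entropy_vars R p0 \<gamma> u \<bullet> euler_flux R p0 \<gamma> u =
      - (1 / 2) * (velocity u)\<^sup>2 * (comp_rho u * velocity u)
      + velocity u * (comp_rho u * (velocity u)\<^sup>2 + P) + \<gamma> / (\<gamma> - 1) * P * velocity u"
    using r by (simp add: entropy_vars_def euler_flux_def inner_prod_def pressure_def m
        power_mult_distrib pw P_def)
  moreover have "total_energy R p0 \<gamma> u = P / (\<gamma> - 1) + 1 / 2 * (comp_rho u * (velocity u)\<^sup>2)"
    using r by (simp add: total_energy_def P_def m power2_eq_square)
  moreover have "flux_potential R p0 \<gamma> u = P * velocity u" "pressure R p0 \<gamma> u = P"
    by (simp_all add: flux_potential_def pressure_def velocity_def P_def)
  moreover have "\<gamma> / (\<gamma> - 1) = 1 + 1 / (\<gamma> - 1)"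
    using assms(2) by (simp add: field_simps)
  ultimately show ?thesis
    by (simp add: algebra_simps power2_eq_square)
qed

end

theory Submission
  imports Defs
begin

text \<open>
  Write \<open>v = m / \<rho>\<close> and \<open>q = \<rho>\<theta>\<close>. The Stolarsky mean is the one that satisfies the chain rule
  \<open>\<gamma> / (\<gamma> - 1) [q\<^sup>\<gamma>\<^sup>-\<^sup>1] {q}\<^sub>\<gamma> = [q\<^sup>\<gamma>]\<close> for the jump \<open>[\<cdot>]\<close>, so the third component of the flux contributes
  \<open>K [q\<^sup>\<gamma>] {v}\<close> to the product of the flux with the jump of the entropy variables. In the first two
  components the unknown mass flux cancels because \<open>[v\<^sup>2] / 2 = {v} [v]\<close>, which leaves \<open>K {q\<^sup>\<gamma>} [v]\<close>.
  By the product rule for jumps the two remaining terms add up to \<open>K [q\<^sup>\<gamma> v]\<close>, the jump of the flux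
  potential.
\<close>

lemma jump_mult:
  "jump (aL * bL) (aR * bR) = amean aL aR * jump bL bR + jump aL aR * amean bL bR"
  by (simp add: jump_def amean_def field_simps)

lemma jump_power2: "jump (a\<^sup>2) (b\<^sup>2) = 2 * amean a b * jump a b" for a b :: real
  by (simp add: jump_def amean_def power2_eq_square algebra_simps)

lemma jump_powr_eq_stolarsky_mean:
  assumes "aL > 0" "aR > 0" "\<gamma> > 1"
  shows "\<gamma> / (\<gamma> - 1) * jump (aL powr (\<gamma> - 1)) (aR powr (\<gamma> - 1)) * stolarsky_mean \<gamma> aL aR
           = jump (aL powr \<gamma>) (aR powr \<gamma>)"
proof (cases "aL = aR")
  case True
  then show ?thesis by (simp add: jump_def)
next
  case False
  \<comment> \<open>The denominator of the mean does not vanish, as \<open>x powr (\<gamma> - 1)\<close> is injective on \<open>x > 0\<close>.\<close>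
  have "aL powr (\<gamma> - 1) \<noteq> aR powr (\<gamma> - 1)"
    using assms False powr_less_mono2[of "\<gamma> - 1" aL aR] powr_less_mono2[of "\<gamma> - 1" aR aL]
    by linarith
  then have "jump (aL powr (\<gamma> - 1)) (aR powr (\<gamma> - 1)) \<noteq> 0"
    by (simp add: jump_def)
  then show ?thesis
    using False assms by (simp add: stolarsky_mean_def)
qed

lemma admissible_rhotheta_pos: "u \<in> admissible \<Longrightarrow> comp_rhotheta u > 0"
  by (auto simp: admissible_def pot_temp_def zero_less_divide_iff)

lemma jump_entropy_vars_inner:
  "jump (entropy_vars R p0 \<gamma> uL) (entropy_vars R p0 \<gamma> uR) \<bullet> g =
     - (1 / 2) * jump ((comp_mom uL / comp_rho uL)\<^sup>2) ((comp_mom uR / comp_rho uR)\<^sup>2) * comp_rho g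
     + jump (comp_mom uL / comp_rho uL) (comp_mom uR / comp_rho uR) * comp_mom g
     + pressure_const R p0 \<gamma> * (\<gamma> / (\<gamma> - 1) *
         jump (comp_rhotheta uL powr (\<gamma> - 1)) (comp_rhotheta uR powr (\<gamma> - 1)) * comp_rhotheta g)"
  by (simp add: jump_def entropy_vars_def inner_prod_def power_divide algebra_simps)

theorem theorem2p2:
  fixes R p0 \<gamma> :: real and f :: numflux
  assumes "R > 0" and "p0 > 0" and "\<gamma> > 1"
    and consistent: "consistent_flux (\<lambda>uL uR. comp_rho (f uL uR))
                       (\<lambda>u. comp_rho (euler_flux R p0 \<gamma> u))"
    and symmetric: "symmetric_flux (\<lambda>uL uR. comp_rho (f uL uR))"
    and momentum: "\<And>uL uR. uL \<in> admissible \<Longrightarrow> uR \<in> admissible \<Longrightarrow>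
        comp_mom (f uL uR) =
          amean (comp_mom uL / comp_rho uL) (comp_mom uR / comp_rho uR) * comp_rho (f uL uR)
            + amean (pressure R p0 \<gamma> uL) (pressure R p0 \<gamma> uR)"
    and rhotheta: "\<And>uL uR. uL \<in> admissible \<Longrightarrow> uR \<in> admissible \<Longrightarrow>
        comp_rhotheta (f uL uR) =
          stolarsky_mean \<gamma> (comp_rhotheta uL) (comp_rhotheta uR)
            * amean (comp_mom uL / comp_rho uL) (comp_mom uR / comp_rho uR)"
  shows "TEC R p0 \<gamma> f"
  unfolding TEC_def
proof (intro ballI)
  fix uL uR
  assume L: "uL \<in> admissible" and R: "uR \<in> admissible"
  define K where "K = pressure_const R p0 \<gamma>"
  define vL where "vL = comp_mom uL / comp_rho uL"
  define vR where "vR = comp_mom uR / comp_rho uR"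
  define qL where "qL = comp_rhotheta uL"
  define qR where "qR = comp_rhotheta uR"
  define F where "F = comp_rho (f uL uR)"
  have pos: "qL > 0" "qR > 0"
    using L R by (simp_all add: qL_def qR_def admissible_rhotheta_pos)
  have mom: "comp_mom (f uL uR) = amean vL vR * F + K * amean (qL powr \<gamma>) (qR powr \<gamma>)"
    using momentum[OF L R]
    by (simp add: pressure_def amean_def K_def vL_def vR_def qL_def qR_def F_def field_simps)
  have rt: "comp_rhotheta (f uL uR) = stolarsky_mean \<gamma> qL qR * amean vL vR"
    using rhotheta[OF L R] by (simp add: vL_def vR_def qL_def qR_def)
  have "jump (entropy_vars R p0 \<gamma> uL) (entropy_vars R p0 \<gamma> uR) \<bullet> f uL uR =
      - (1 / 2) * jump (vL\<^sup>2) (vR\<^sup>2) * F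
      + jump vL vR * (amean vL vR * F + K * amean (qL powr \<gamma>) (qR powr \<gamma>))
      + K * ((\<gamma> / (\<gamma> - 1) * jump (qL powr (\<gamma> - 1)) (qR powr (\<gamma> - 1)) * stolarsky_mean \<gamma> qL qR)
          * amean vL vR)"
    by (simp only: jump_entropy_vars_inner mom rt mult.assoc
        flip: K_def vL_def vR_def qL_def qR_def F_def)
  also have "\<dots> = K * (amean (qL powr \<gamma>) (qR powr \<gamma>) * jump vL vR
                    + jump (qL powr \<gamma>) (qR powr \<gamma>) * amean vL vR)"
    unfolding jump_powr_eq_stolarsky_mean[OF pos \<open>\<gamma> > 1\<close>] jump_power2
    by (simp add: algebra_simps)
  also have "\<dots> = K * jump (qL powr \<gamma> * vL) (qR powr \<gamma> * vR)"
    by (simp only: jump_mult)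
  also have "\<dots> = jump (flux_potential R p0 \<gamma> uL) (flux_potential R p0 \<gamma> uR)"
    by (simp add: jump_def flux_potential_def K_def vL_def vR_def qL_def qR_def algebra_simps)
  finally show "jump (entropy_vars R p0 \<gamma> uL) (entropy_vars R p0 \<gamma> uR) \<bullet> f uL uR
      = jump (flux_potential R p0 \<gamma> uL) (flux_potential R p0 \<gamma> uR)" .
qed

end
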